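(* Let $\Omega=\{1,2\}$ and let $\mathcal{Q}$ be the convex hull of the two probability measures $\mathbb{Q}_1=(\tfrac14,\tfrac34)$ and $\mathbb{Q}_2=(\tfrac34,\tfrac14)$ on $\Omega$ (written as (probability of scenario 1, probability of scenario 2)), and let $\mathbb{F}[Z]=\min_{\mathbb{Q}\in\mathcal{Q}}\mathbb{E}_{\mathbb{Q}}[Z]$. Take the parameters $$V_1=4,\quad V_2=\tfrac{48}{5},\quad c=\tfrac{23}{2},\quad c_1=1,\quad c_2=\tfrac72,\quad r_1=2,\quad r_2=10 .$$ Then the risk-averse social planner problem $\mathrm{RaSp}(\mathbb{F})$ has a unique optimal solution, while the risk-averse equilibrium problem without Arrow-Debreu securities $\mathrm{RaEq}(\mathbb{F})$ has three different equilibria, i.e. there exist three pairwise distinct price vectors $(\pi_1,\pi_2)\in\mathbb{R}^2$ that are equilibria of $\mathrm{RaEq}(\mathbb{F})$.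
   Context: A producer chooses a first-stage production $x\in\mathbb{R}$ and recourse productions $x_1,x_2\in\mathbb{R}$ (one per scenario $i\in\{1,2\}$); a consumer chooses consumptions $y_1,y_2\in\mathbb{R}$. The welfares in scenario $i$ (ignoring payments) are $$W_p(i)=-\tfrac12 c x^2-\tfrac12 c_i x_i^2,\qquad W_c(i)=V_i y_i-\tfrac12 r_i y_i^2,\qquad W_{sp}(i)=W_p(i)+W_c(i).$$ $\mathrm{RaSp}(\mathbb{F})$ is the problem of maximizing $\mathbb{F}[W_{sp}]$ over $(x,x_1,x_2,y_1,y_2)$ subject to $x+x_i\ge y_i$ for $i=1,2$. An equilibrium of $\mathrm{RaEq}(\mathbb{F})$ is a price vector $\pi=(\pi_1,\pi_2)$ for which there exist $(x,x_1,x_2,y_1,y_2)$ such that: (1) $(x,x_1,x_2)$ maximizes $\mathbb{F}[W_p+\pi(x+x_r)]$, where $W_p+\pi(x+x_r)$ denotes the random variable $i\mapsto W_p(i)+\pi_i(x+x_i)$; (2) for each $i$, $y_i$ maximizes $W_c(i)-\pi_i y_i$; (3) for each $i$, $0\le x+x_i-y_i$, $\pi_i\ge 0$ and $\pi_i(x+x_i-y_i)=0$. *)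

theory Defs
  imports "HOL-Probability.Probability"
begin

text \<open>
  The sample space \<open>\<Omega> = {1, 2}\<close> is the two-element type \<^typ>\<open>2\<close>, in which \<open>2 = 0\<close> and
  \<open>UNIV = {1, 2}\<close>. A measure on \<open>\<Omega>\<close> is given by its vector of point masses in \<^typ>\<open>real^2\<close>, so that
  convex hulls of sets of measures make sense; \<open>vector [a, b]\<close> has component \<open>a\<close> at \<open>1\<close> and \<open>b\<close>
  at \<open>2\<close>. Random variables are functions on \<open>\<Omega>\<close>.
\<close>

definition scenario_measure :: "real^2 \<Rightarrow> 2 measure" where
  "scenario_measure q = point_measure UNIV (\<lambda>i. ennreal (q $ i))"

definition expect :: "real^2 \<Rightarrow> (2 \<Rightarrow> real) \<Rightarrow> real" where
  "expect q Z = (\<integral>i. Z i \<partial>scenario_measure q)"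

text \<open>
  The infimum below is a minimum whenever \<open>Q\<close> is a nonempty compact set of nonnegative vectors,
  see \<open>worst_case_attained\<close>.
\<close>

definition worst_case :: "(real^2) set \<Rightarrow> (2 \<Rightarrow> real) \<Rightarrow> real" where
  "worst_case Q Z = (INF q\<in>Q. expect q Z)"

lemma prob_space_scenario_measure:
  assumes "\<And>i. 0 \<le> q $ i" "(\<Sum>i\<in>UNIV. q $ i) = 1"
  shows "prob_space (scenario_measure q)"
  unfolding scenario_measure_def using assms
  by (intro prob_spaceI) (simp add: space_point_measure emeasure_point_measure_finite sum_ennreal)

lemma expect_eq_sum:
  assumes "\<And>i. 0 \<le> q $ i"
  shows "expect q Z = (\<Sum>i\<in>UNIV. q $ i * Z i)"
  unfolding expect_def scenario_measure_def
  using assms by (subst lebesgue_integral_point_measure_finite) auto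

lemma worst_case_attained:
  assumes "compact Q" "Q \<noteq> {}" "\<And>q i. q \<in> Q \<Longrightarrow> 0 \<le> q $ i"
  shows "\<exists>q\<in>Q. worst_case Q Z = expect q Z \<and> (\<forall>q'\<in>Q. expect q Z \<le> expect q' Z)"
proof -
  have "continuous_on Q (\<lambda>q. \<Sum>i\<in>UNIV. q $ i * Z i)"
    by (intro continuous_intros)
  then have "continuous_on Q (\<lambda>q. expect q Z)"
    by (rule continuous_on_eq) (simp add: expect_eq_sum assms(3))
  from continuous_attains_inf[OF assms(1,2) this] obtain q
    where q: "q \<in> Q" "\<forall>q'\<in>Q. expect q Z \<le> expect q' Z" by blast
  then have "worst_case Q Z = expect q Z"
    unfolding worst_case_def by (intro cInf_eq_minimum) auto
  with q show ?thesis by blast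
qed

definition W_p :: "real \<Rightarrow> real^2 \<Rightarrow> 2 \<Rightarrow> real \<Rightarrow> real \<Rightarrow> real" where
  "W_p c cr i x xi = - (1/2) * c * x\<^sup>2 - (1/2) * cr $ i * xi\<^sup>2"

definition W_c :: "real^2 \<Rightarrow> real^2 \<Rightarrow> 2 \<Rightarrow> real \<Rightarrow> real" where
  "W_c V r i yi = V $ i * yi - (1/2) * r $ i * yi\<^sup>2"

definition W_sp ::
  "real \<Rightarrow> real^2 \<Rightarrow> real^2 \<Rightarrow> real^2 \<Rightarrow> 2 \<Rightarrow> real \<Rightarrow> real \<Rightarrow> real \<Rightarrow> real" where
  "W_sp c cr V r i x xi yi = W_p c cr i x xi + W_c V r i yi"

text \<open>
  In the following, \<open>c\<close>, \<open>cr\<close>, \<open>V\<close>, \<open>r\<close> are the parameters \<open>c\<close>, \<open>(c\<^sub>1, c\<^sub>2)\<close>, \<open>(V\<^sub>1, V\<^sub>2)\<close>,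
  \<open>(r\<^sub>1, r\<^sub>2)\<close>, and the decisions are \<open>x\<close>, \<open>xr = (x\<^sub>1, x\<^sub>2)\<close> and \<open>y = (y\<^sub>1, y\<^sub>2)\<close>.
\<close>

definition RaSp_solution ::
  "((2 \<Rightarrow> real) \<Rightarrow> real) \<Rightarrow> real \<Rightarrow> real^2 \<Rightarrow> real^2 \<Rightarrow> real^2 \<Rightarrow>
    real \<times> (real^2) \<times> (real^2) \<Rightarrow> bool" where
  "RaSp_solution F c cr V r =
    is_arg_max (\<lambda>(x, xr, y). F (\<lambda>i. W_sp c cr V r i x (xr $ i) (y $ i)))
      (\<lambda>(x, xr, y). \<forall>i. x + xr $ i \<ge> y $ i)"

definition RaEq_equilibrium ::
  "((2 \<Rightarrow> real) \<Rightarrow> real) \<Rightarrow> real \<Rightarrow> real^2 \<Rightarrow> real^2 \<Rightarrow> real^2 \<Rightarrow> real^2 \<Rightarrow> bool" where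
  "RaEq_equilibrium F c cr V r \<pi> \<longleftrightarrow>
    (\<exists>x xr y.
      is_arg_max (\<lambda>(x, xr). F (\<lambda>i. W_p c cr i x (xr $ i) + \<pi> $ i * (x + xr $ i)))
        (\<lambda>_. True) (x, xr) \<and>
      (\<forall>i. is_arg_max (\<lambda>yi. W_c V r i yi - \<pi> $ i * yi) (\<lambda>_. True) (y $ i)) \<and>
      (\<forall>i. 0 \<le> x + xr $ i - y $ i \<and> 0 \<le> \<pi> $ i \<and> \<pi> $ i * (x + xr $ i - y $ i) = 0))"

end

theory Submission
  imports Defs
begin

text \<open>
  For a fixed measure \<open>q\<close> the first-order conditions of the planner and of the equilibrium problem
  coincide: \<open>c x = E\<^sub>q[\<pi>]\<close>, \<open>x\<^sub>i = \<pi>\<^sub>i / c\<^sub>i\<close>, \<open>y\<^sub>i = (V\<^sub>i - \<pi>\<^sub>i) / r\<^sub>i\<close> and \<open>x + x\<^sub>i = y\<^sub>i\<close>. They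
  differ in which \<open>q\<close> is admissible: \<open>q\<close> must be a worst case for the total welfare in the planner
  problem, but for the revenue-adjusted producer welfare in the equilibrium problem. Total welfare
  makes scenario 1 the bad one at \<open>q = (3/4, 1/4)\<close>, and strict concavity of \<open>E\<^sub>q\<close> gives
  uniqueness. The producer welfare is smaller in scenario 1 at \<open>q = (3/4, 1/4)\<close> and smaller in
  scenario 2 at \<open>q = (1/4, 3/4)\<close>, so both extreme measures give equilibria; by the intermediate value
  theorem there is a third one between them where the producer is indifferent between the scenarios.
\<close>

section \<open>Worst-case expectations and quadratic expansions of the welfares\<close>

lemma worst_case_le_expect:
  assumes "compact Q" "\<And>q i. q \<in> Q \<Longrightarrow> 0 \<le> q $ i" "q \<in> Q"
  shows "worst_case Q Z \<le> expect q Z"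
proof -
  obtain q' where "worst_case Q Z = expect q' Z" "\<forall>q\<in>Q. expect q' Z \<le> expect q Z"
    using worst_case_attained[of Q Z] assms by (metis empty_iff)
  then show ?thesis using assms(3) by simp
qed

lemma worst_case_eq_expect:
  assumes "q \<in> Q" "\<And>q'. q' \<in> Q \<Longrightarrow> expect q Z \<le> expect q' Z"
  shows "worst_case Q Z = expect q Z"
  unfolding worst_case_def using assms by (intro cInf_eq_minimum) auto

text \<open>Exact Taylor expansion at \<open>(x', p / cr $ i)\<close>. The recourse is optimized in
  each scenario separately, so it has no linear term; the first-stage decision is shared, so its
  linear term can only be removed by averaging.\<close>

lemma W_p_expansion:
  assumes "cr $ i \<noteq> 0"
  shows "W_p c cr i x u + p * (x + u) =
    W_p c cr i x' (p / cr $ i) + p * (x' + p / cr $ i) + (p - c * x') * (x - x')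
      - c / 2 * (x - x')\<^sup>2 - cr $ i / 2 * (u - p / cr $ i)\<^sup>2"
  using assms unfolding W_p_def by (simp add: field_simps power2_eq_square)

lemma W_c_expansion:
  assumes "r $ i \<noteq> 0"
  shows "W_c V r i u - p * u =
    W_c V r i ((V $ i - p) / r $ i) - p * ((V $ i - p) / r $ i)
      - r $ i / 2 * (u - (V $ i - p) / r $ i)\<^sup>2"
  using assms unfolding W_c_def by (simp add: field_simps power2_eq_square)

section \<open>Saddle-point conditions in a two-scenario market\<close>

locale market =
  fixes Q :: "(real^2) set" and c :: real and cr V r :: "real^2"
  assumes compact_Q: "compact Q"
    and Q_nonneg: "\<And>q i. q \<in> Q \<Longrightarrow> 0 \<le> q $ i"
    and Q_sum: "\<And>q. q \<in> Q \<Longrightarrow> q $ 1 + q $ 2 = 1"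
    and c_pos: "0 < c" and cr_pos: "\<And>i. 0 < cr $ i" and r_pos: "\<And>i. 0 < r $ i"
begin

lemma expect_Q: "q \<in> Q \<Longrightarrow> expect q Z = q $ 1 * Z 1 + q $ 2 * Z 2"
  by (simp add: expect_eq_sum Q_nonneg sum_2)

text \<open>The linear term has mean 0, as \<open>q\<close> has total mass 1. In the uses below,
  \<open>d\<close> is the first-stage displacement, \<open>e\<close> the first-stage loss and
  \<open>f\<close> the scenario losses.\<close>

lemma first_order_expect:
  assumes "q \<in> Q" "c * x = q $ 1 * \<pi> $ 1 + q $ 2 * \<pi> $ 2"
  shows "expect q (\<lambda>i. Z i + (\<pi> $ i - c * x) * d - e - f i) = expect q Z - e - expect q f"
proof -
  have q2: "q $ 2 = 1 - q $ 1" using Q_sum[OF assms(1)] by simp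
  show ?thesis
    unfolding expect_Q[OF assms(1)] assms(2) q2 by (simp add: algebra_simps)
qed

lemma expect_nonneg:
  assumes "q \<in> Q" "\<And>i. 0 \<le> f i"
  shows "0 \<le> expect q f"
  unfolding expect_Q[OF assms(1)] using assms Q_nonneg by simp

lemma expect_eq_0_iff:
  assumes "q \<in> Q" "\<And>i. 0 < q $ i" "\<And>i. 0 \<le> f i"
  shows "expect q f = 0 \<longleftrightarrow> (\<forall>i. f i = 0)"
  unfolding expect_Q[OF assms(1)] forall_2
  using assms(2)[of 1] assms(2)[of 2] assms(3)
  by (simp add: add_nonneg_eq_0_iff)

text \<open>Saddle-point argument: \<open>worst_case Q\<close> is at most \<open>expect q\<close>,
  which is maximal at the candidate, and \<open>worst\<close> makes the two agree there.\<close>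

lemma equilibriumI:
  assumes q: "q \<in> Q" and x: "c * x = q $ 1 * \<pi> $ 1 + q $ 2 * \<pi> $ 2"
    and clear: "\<And>i. x + \<pi> $ i / cr $ i = (V $ i - \<pi> $ i) / r $ i"
    and nonneg: "\<And>i. 0 \<le> \<pi> $ i"
    and worst: "\<And>q'. q' \<in> Q \<Longrightarrow>
      expect q (\<lambda>i. W_p c cr i x (\<pi> $ i / cr $ i) + \<pi> $ i * (x + \<pi> $ i / cr $ i)) \<le>
      expect q' (\<lambda>i. W_p c cr i x (\<pi> $ i / cr $ i) + \<pi> $ i * (x + \<pi> $ i / cr $ i))"
  shows "RaEq_equilibrium (worst_case Q) c cr V r \<pi>"
proof -
  let ?Z = "\<lambda>x u i. W_p c cr i x (u $ i) + \<pi> $ i * (x + u $ i)"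
  define xr :: "real^2" where "xr = (\<chi> i. \<pi> $ i / cr $ i)"
  define y :: "real^2" where "y = (\<chi> i. (V $ i - \<pi> $ i) / r $ i)"
  have cr0: "cr $ i \<noteq> 0" and r0: "r $ i \<noteq> 0" for i
    using cr_pos[of i] r_pos[of i] by auto
  have "worst_case Q (?Z x' u) \<le> worst_case Q (?Z x xr)" for x' u
  proof -
    let ?f = "\<lambda>i. cr $ i / 2 * (u $ i - \<pi> $ i / cr $ i)\<^sup>2"
    have "worst_case Q (?Z x' u) \<le> expect q (?Z x' u)"
      by (rule worst_case_le_expect[OF compact_Q Q_nonneg q])
    also have "\<dots> = expect q (\<lambda>i. ?Z x xr i + (\<pi> $ i - c * x) * (x' - x)
        - c / 2 * (x' - x)\<^sup>2 - ?f i)"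
      by (subst W_p_expansion[OF cr0, where x' = x]) (simp add: xr_def)
    also have "\<dots> = expect q (?Z x xr) - c / 2 * (x' - x)\<^sup>2 - expect q ?f"
      by (rule first_order_expect[OF q x])
    also have "\<dots> \<le> expect q (?Z x xr)"
    proof -
      have "0 \<le> expect q ?f" using cr_pos by (intro expect_nonneg q) (simp add: less_imp_le)
      moreover have "0 \<le> c / 2 * (x' - x)\<^sup>2" using c_pos by simp
      ultimately show ?thesis by linarith
    qed
    also have "\<dots> = worst_case Q (?Z x xr)"
      using worst by (intro worst_case_eq_expect[symmetric] q) (simp add: xr_def)
    finally show ?thesis .
  qed
  then have "is_arg_max (\<lambda>(x, xr). worst_case Q (?Z x xr)) (\<lambda>_. True) (x, xr)"
    by (auto simp: is_arg_max_def not_less)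
  moreover have "is_arg_max (\<lambda>u. W_c V r i u - \<pi> $ i * u) (\<lambda>_. True) (y $ i)" for i
    unfolding is_arg_max_def
    by (subst (2) W_c_expansion[OF r0]) (use r_pos[of i] in \<open>simp add: y_def not_less\<close>)
  moreover have "x + xr $ i - y $ i = 0" for i
    using clear[of i] by (simp add: xr_def y_def)
  ultimately show ?thesis
    unfolding RaEq_equilibrium_def using nonneg by (intro exI[of _ x] exI[of _ xr] exI[of _ y]) simp
qed

text \<open>The same saddle point, with \<open>\<pi>\<close> as multiplier of the constraints.
  Positive masses in \<open>q\<close> make every other feasible decision strictly worse.\<close>

lemma planner_unique_solution:
  assumes q: "q \<in> Q" and q_pos: "\<And>i. 0 < q $ i"
    and x: "c * x = q $ 1 * \<pi> $ 1 + q $ 2 * \<pi> $ 2"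
    and clear: "\<And>i. x + \<pi> $ i / cr $ i = (V $ i - \<pi> $ i) / r $ i"
    and nonneg: "\<And>i. 0 \<le> \<pi> $ i"
    and worst: "\<And>q'. q' \<in> Q \<Longrightarrow>
      expect q (\<lambda>i. W_sp c cr V r i x (\<pi> $ i / cr $ i) ((V $ i - \<pi> $ i) / r $ i)) \<le>
      expect q' (\<lambda>i. W_sp c cr V r i x (\<pi> $ i / cr $ i) ((V $ i - \<pi> $ i) / r $ i))"
  shows "\<exists>!s. RaSp_solution (worst_case Q) c cr V r s"
proof -
  let ?W = "\<lambda>x u v i. W_sp c cr V r i x (u $ i) (v $ i)"
  define xr :: "real^2" where "xr = (\<chi> i. \<pi> $ i / cr $ i)"
  define y :: "real^2" where "y = (\<chi> i. (V $ i - \<pi> $ i) / r $ i)"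
  have cr0: "cr $ i \<noteq> 0" and r0: "r $ i \<noteq> 0" for i
    using cr_pos[of i] r_pos[of i] by auto
  have xy: "x + xr $ i = y $ i" for i
    using clear[of i] by (simp add: xr_def y_def)
  have less: "worst_case Q (?W x' u v) < worst_case Q (?W x xr y)"
    if feas: "\<forall>i. x' + u $ i \<ge> v $ i" and ne: "(x', u, v) \<noteq> (x, xr, y)" for x' u v
  proof -
    \<comment> \<open>When the two expansions are added, the payments cancel up to price times
      surplus. This last term is nonnegative at feasible decisions and counts as a loss.\<close>
    let ?f = "\<lambda>i. cr $ i / 2 * (u $ i - xr $ i)\<^sup>2 + r $ i / 2 * (v $ i - y $ i)\<^sup>2
      + \<pi> $ i * (x' + u $ i - v $ i)"
    have f0: "0 \<le> ?f i" for i
      using cr_pos[of i] r_pos[of i] nonneg[of i] feas by simp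
    have eq: "?W x' u v i = ?W x xr y i + (\<pi> $ i - c * x) * (x' - x) - c / 2 * (x' - x)\<^sup>2 - ?f i"
      for i
    proof -
      have *: "\<pi> $ i * (x + xr $ i) = \<pi> $ i * y $ i"
        using xy by simp
      show ?thesis
        using W_p_expansion[OF cr0, of c i x' "u $ i" "\<pi> $ i" x]
          W_c_expansion[OF r0, of V i "v $ i" "\<pi> $ i"] *
        unfolding W_sp_def by (simp add: xr_def y_def algebra_simps)
    qed
    have pos: "0 < c / 2 * (x' - x)\<^sup>2 + expect q ?f"
    proof (rule ccontr)
      assume "\<not> ?thesis"
      moreover have "0 \<le> c / 2 * (x' - x)\<^sup>2" using c_pos by simp
      moreover have "0 \<le> expect q ?f" by (rule expect_nonneg[OF q f0])
      ultimately have "c / 2 * (x' - x)\<^sup>2 = 0" and "expect q ?f = 0"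
        by linarith+
      then have "x' = x" and f: "\<forall>i. ?f i = 0"
        using c_pos expect_eq_0_iff[OF q q_pos f0] by simp_all
      have "u $ i = xr $ i \<and> v $ i = y $ i" for i
      proof -
        have "0 \<le> cr $ i / 2 * (u $ i - xr $ i)\<^sup>2" "0 \<le> r $ i / 2 * (v $ i - y $ i)\<^sup>2"
          "0 \<le> \<pi> $ i * (x' + u $ i - v $ i)"
          using cr_pos[of i] r_pos[of i] nonneg[of i] feas by simp_all
        then have "cr $ i / 2 * (u $ i - xr $ i)\<^sup>2 = 0" "r $ i / 2 * (v $ i - y $ i)\<^sup>2 = 0"
          using f[rule_format, of i] by linarith+
        then show ?thesis using cr0 r0 by simp
      qed
      with \<open>x' = x\<close> ne show False by (simp add: vec_eq_iff)
    qed
    have "worst_case Q (?W x' u v) \<le> expect q (?W x' u v)"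
      by (rule worst_case_le_expect[OF compact_Q Q_nonneg q])
    also have "\<dots> = expect q (?W x xr y) - c / 2 * (x' - x)\<^sup>2 - expect q ?f"
      unfolding eq by (rule first_order_expect[OF q x])
    also have "\<dots> < expect q (?W x xr y)"
      using pos by simp
    also have "\<dots> = worst_case Q (?W x xr y)"
      using worst by (intro worst_case_eq_expect[symmetric] q) (simp add: xr_def y_def)
    finally show ?thesis .
  qed
  have feas: "\<forall>i. y $ i \<le> x + xr $ i"
    using xy by simp
  have "RaSp_solution (worst_case Q) c cr V r s \<longleftrightarrow> s = (x, xr, y)" for s
  proof (cases s)
    case s: (fields x' u v)
    show ?thesis
    proof (cases "s = (x, xr, y)")
      case True
      have "\<not> worst_case Q (?W x xr y) < worst_case Q (?W x' u v)"
        if "\<forall>i. x' + u $ i \<ge> v $ i" for x' u v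
        using less[OF that] by (cases "(x', u, v) = (x, xr, y)") auto
      with True feas show ?thesis
        unfolding RaSp_solution_def is_arg_max_def by (simp, blast)
    next
      case False
      have "\<not> RaSp_solution (worst_case Q) c cr V r (x', u, v)"
      proof
        assume "RaSp_solution (worst_case Q) c cr V r (x', u, v)"
        note sol = this[unfolded RaSp_solution_def is_arg_max_def]
        have "\<forall>i. v $ i \<le> x' + u $ i"
          using conjunct1[OF sol] by simp
        moreover have "(x', u, v) \<noteq> (x, xr, y)"
          using False s by simp
        ultimately have "worst_case Q (?W x' u v) < worst_case Q (?W x xr y)"
          by (rule less)
        then have "\<exists>s'. (case s' of (x, u, v) \<Rightarrow> \<forall>i. v $ i \<le> x + u $ i) \<and>
            (case (x', u, v) of (x, u, v) \<Rightarrow> worst_case Q (?W x u v)) <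
            (case s' of (x, u, v) \<Rightarrow> worst_case Q (?W x u v))"
          using feas by (intro exI[of _ "(x, xr, y)"]) simp
        with conjunct2[OF sol] show False ..
      qed
      with False s show ?thesis by blast
    qed
  qed
  then show ?thesis by simp
qed

end

section \<open>The instance with three equilibria\<close>

lemma mem_convex_hull_extreme_measures:
  "q \<in> convex hull {vector [1/4, 3/4], vector [3/4, 1/4] :: real^2} \<longleftrightarrow>
    1/4 \<le> q $ 1 \<and> q $ 1 \<le> 3/4 \<and> q $ 2 = 1 - q $ 1"
proof
  assume "q \<in> convex hull {vector [1/4, 3/4], vector [3/4, 1/4]}"
  then obtain u v :: real where "0 \<le> u" "0 \<le> v" "u + v = 1"
    "q = u *\<^sub>R vector [1/4, 3/4] + v *\<^sub>R vector [3/4, 1/4]"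
    by (auto simp: convex_hull_2)
  then show "1/4 \<le> q $ 1 \<and> q $ 1 \<le> 3/4 \<and> q $ 2 = 1 - q $ 1"
    by simp
next
  assume q: "1/4 \<le> q $ 1 \<and> q $ 1 \<le> 3/4 \<and> q $ 2 = 1 - q $ 1"
  then have "q = (3/2 - 2 * q $ 1) *\<^sub>R vector [1/4, 3/4] + (2 * q $ 1 - 1/2) *\<^sub>R vector [3/4, 1/4]"
    by (simp add: vec_eq_iff forall_2 field_simps)
  with q show "q \<in> convex hull {vector [1/4, 3/4], vector [3/4, 1/4]}"
    unfolding convex_hull_2 by fastforce
qed

theorem mainTheorem1:
  fixes \<Q> :: "(real^2) set" and F :: "(2 \<Rightarrow> real) \<Rightarrow> real"
    and c :: real and cr V r :: "real^2"
  assumes "\<Q> = convex hull {vector [1/4, 3/4], vector [3/4, 1/4]}"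
    and "F = worst_case \<Q>"
    and "V = vector [4, 48/5]"
    and "c = 23/2"
    and "cr = vector [1, 7/2]"
    and "r = vector [2, 10]"
  shows "(\<exists>!s. RaSp_solution F c cr V r s) \<and>
    (\<exists>\<pi> \<pi>' \<pi>''. \<pi> \<noteq> \<pi>' \<and> \<pi> \<noteq> \<pi>'' \<and> \<pi>' \<noteq> \<pi>'' \<and>
      RaEq_equilibrium F c cr V r \<pi> \<and>
      RaEq_equilibrium F c cr V r \<pi>' \<and>
      RaEq_equilibrium F c cr V r \<pi>'')"
proof -
  interpret market \<Q> c cr V r
  proof
    show "compact \<Q>"
      unfolding assms by (intro finite_imp_compact_convex_hull) simp
    show "0 \<le> q $ i" if "q \<in> \<Q>" for q i
      using that exhaust_2[of i] by (auto simp: assms(1) mem_convex_hull_extreme_measures)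
    show "q $ 1 + q $ 2 = 1" if "q \<in> \<Q>" for q
      using that by (simp add: assms(1) mem_convex_hull_extreme_measures)
    show "0 < cr $ i" "0 < r $ i" for i
      using exhaust_2[of i] by (auto simp: assms)
  qed (simp add: assms)
  have \<Q>: "q \<in> \<Q> \<longleftrightarrow> 1/4 \<le> q $ 1 \<and> q $ 1 \<le> 3/4 \<and> q $ 2 = 1 - q $ 1" for q
    by (simp add: assms(1) mem_convex_hull_extreme_measures)
  have expect_\<Q>: "expect q Z = Z 2 + q $ 1 * (Z 1 - Z 2)" if "q \<in> \<Q>" for q Z
  proof -
    have q2: "q $ 2 = 1 - q $ 1" using that by (simp add: \<Q>)
    show ?thesis unfolding expect_Q[OF that] q2 by (simp add: algebra_simps)
  qed

  have qA: "vector [3/4, 1/4] \<in> \<Q>" and qB: "vector [1/4, 3/4] \<in> \<Q>"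
    by (simp_all add: \<Q>)
  \<comment> \<open>The expectation is affine in \<open>q $ 1\<close> with slope
    \<open>Z 1 - Z 2\<close>, so the sign of the slope decides which end of
    \<open>[1/4, 3/4]\<close> is worst.\<close>
  have expect_qA: "expect (vector [3/4, 1/4]) Z \<le> expect q Z"
    if "q \<in> \<Q>" "Z 1 \<le> Z 2" for q Z
    unfolding expect_\<Q>[OF that(1)] expect_\<Q>[OF qA]
    using that by (intro add_left_mono mult_right_mono_neg) (simp_all add: \<Q>)
  have expect_qB: "expect (vector [1/4, 3/4]) Z \<le> expect q Z"
    if "q \<in> \<Q>" "Z 2 \<le> Z 1" for q Z
    unfolding expect_\<Q>[OF that(1)] expect_\<Q>[OF qB]
    using that by (intro add_left_mono mult_right_mono) (simp_all add: \<Q>)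

  \<comment> \<open>the market-clearing prices for a given first-stage production \<open>x\<close>\<close>
  define \<pi>1 \<pi>2 :: "real \<Rightarrow> real" where "\<pi>1 x = (4 - 2 * x) / 3" and "\<pi>2 x = 70/27 * (24/25 - x)" for x
  define \<pi> :: "real \<Rightarrow> real^2" where "\<pi> x = vector [\<pi>1 x, \<pi>2 x]" for x
  have clear: "x + \<pi> x $ i / cr $ i = (V $ i - \<pi> x $ i) / r $ i" for x i
    using exhaust_2[of i] by (auto simp: assms \<pi>_def \<pi>1_def \<pi>2_def field_simps)
  \<comment> \<open>The bound \<open>24/25\<close> is the zero of \<open>\<pi>2\<close>; that of
    \<open>\<pi>1\<close> is \<open>2\<close>.\<close>
  have nonneg: "0 \<le> \<pi> x $ i" if "x \<le> 24/25" for x i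
    using exhaust_2[of i] that by (auto simp: \<pi>_def \<pi>1_def \<pi>2_def)
  define Z where "Z x i = W_p c cr i x (\<pi> x $ i / cr $ i) + \<pi> x $ i * (x + \<pi> x $ i / cr $ i)" for x i
  have Z_diff: "Z x 1 - Z x 2 = (\<pi>1 x - \<pi>2 x) * x + (\<pi>1 x)\<^sup>2 / 2 - (\<pi>2 x)\<^sup>2 / 7" for x
    by (simp add: Z_def W_p_def \<pi>_def assms field_simps power2_eq_square)
  \<comment> \<open>the solutions of the linear equation \<open>c x = E\<^sub>q[\<pi> x]\<close> at the two extreme measures\<close>
  define xA xB :: real where "xA = 438/3415" and "xB = 198/1225"
  have ZA: "Z xA 1 < Z xA 2" and ZB: "Z xB 2 < Z xB 1"
    using Z_diff[of xA] Z_diff[of xB] by (simp_all add: xA_def xB_def \<pi>1_def \<pi>2_def power2_eq_square)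
  have xA:
    "c * xA = (vector [3/4, 1/4] :: real^2) $ 1 * \<pi> xA $ 1 + (vector [3/4, 1/4] :: real^2) $ 2 * \<pi> xA $ 2"
    by (simp add: assms \<pi>_def \<pi>1_def \<pi>2_def xA_def)
  have xB:
    "c * xB = (vector [1/4, 3/4] :: real^2) $ 1 * \<pi> xB $ 1 + (vector [1/4, 3/4] :: real^2) $ 2 * \<pi> xB $ 2"
    by (simp add: assms \<pi>_def \<pi>1_def \<pi>2_def xB_def)

  have planner: "\<exists>!s. RaSp_solution F c cr V r s"
    unfolding assms(2)
  proof (rule planner_unique_solution[OF qA _ xA clear nonneg expect_qA])
    show "0 < (vector [3/4, 1/4] :: real^2) $ i" for i
      using exhaust_2[of i] by auto
  qed (simp_all add: W_sp_def W_p_def W_c_def assms \<pi>_def \<pi>1_def \<pi>2_def xA_def power2_eq_square)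

  have eqA: "RaEq_equilibrium F c cr V r (\<pi> xA)"
    unfolding assms(2)
    by (rule equilibriumI[OF qA xA clear nonneg expect_qA])
      (use ZA in \<open>simp_all add: Z_def xA_def\<close>)
  have eqB: "RaEq_equilibrium F c cr V r (\<pi> xB)"
    unfolding assms(2)
    by (rule equilibriumI[OF qB xB clear nonneg expect_qB])
      (use ZB in \<open>simp_all add: Z_def xB_def\<close>)

  \<comment> \<open>At a zero of this difference the expectation is the same under all of
    \<open>\<Q>\<close>, so every measure in \<open>\<Q>\<close> is a worst case and only the
    first-order condition remains to be met.\<close>
  have "continuous_on {xA..xB} (\<lambda>x. Z x 1 - Z x 2)"
    unfolding Z_diff \<pi>1_def \<pi>2_def by (intro continuous_intros) auto
  moreover have "xA \<le> xB" by (simp add: xA_def xB_def)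
  ultimately obtain xC where xC: "xA \<le> xC" "xC \<le> xB" and "Z xC 1 - Z xC 2 = 0"
    using IVT'[of "\<lambda>x. Z x 1 - Z x 2" xA 0 xB] ZA ZB by auto
  then have ZC: "Z xC 1 = Z xC 2" by simp
  have ne: "xC \<noteq> xA" "xC \<noteq> xB" using ZA ZB ZC by auto
  \<comment> \<open>the weight of scenario 1 solving \<open>c x = t \<pi>\<^sub>1 + (1 - t) \<pi>\<^sub>2\<close>\<close>
  define t where "t = (\<pi>2 xC - c * xC) / (\<pi>2 xC - \<pi>1 xC)"
  have gap: "0 < \<pi>2 xC - \<pi>1 xC"
    using xC by (simp add: \<pi>1_def \<pi>2_def xB_def)
  \<comment> \<open>After clearing the denominator, \<open>1/4 \<le> t\<close> becomes
    \<open>xC \<le> xB\<close> and \<open>t \<le> 3/4\<close> becomes \<open>xA \<le> xC\<close>,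
    because \<open>xB\<close> and \<open>xA\<close> solve the corresponding equations.\<close>
  have "1/4 \<le> t" "t \<le> 3/4"
    using gap xC unfolding t_def
    by (simp_all add: le_divide_eq divide_le_eq) (simp_all add: \<pi>1_def \<pi>2_def xA_def xB_def assms field_simps)
  then have qC: "vector [t, 1 - t] \<in> \<Q>"
    by (simp add: \<Q>)
  have "t * (\<pi>2 xC - \<pi>1 xC) = \<pi>2 xC - c * xC"
    using gap by (simp add: t_def)
  then have xC':
    "c * xC = (vector [t, 1 - t] :: real^2) $ 1 * \<pi> xC $ 1 + (vector [t, 1 - t] :: real^2) $ 2 * \<pi> xC $ 2"
    by (simp add: \<pi>_def algebra_simps)
  have eqC: "RaEq_equilibrium F c cr V r (\<pi> xC)"
    unfolding assms(2)
    by (rule equilibriumI[OF qC xC' clear nonneg])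
      (use ZC xC qC in \<open>simp_all add: expect_\<Q> Z_def xB_def\<close>)

  \<comment> \<open>The first price alone separates the equilibria, as \<open>\<pi>1\<close> is
    strictly decreasing.\<close>
  have inj: "\<pi> x \<noteq> \<pi> x'" if "x \<noteq> x'" for x x'
    using that by (simp add: \<pi>_def \<pi>1_def vec_eq_iff forall_2)
  have "xA \<noteq> xB" by (simp add: xA_def xB_def)
  then show ?thesis
    using planner eqA eqB eqC inj ne by metis
qed

end
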